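(* Let $(X,\to,{}^*,1)$ be a complete implicative-orthomodular lattice. Then the associated orthogonality space $(X',\perp)$, where $X'=X\setminus\{0\}$, is a Sasaki space.
   Context: A BE algebra is an algebra $(X,\to,1)$ such that for all $x,y,z\in X$: $x\to x=1$; $x\to 1=1$; $1\to x=x$; $x\to(y\to z)=y\to(x\to z)$. It carries the relation $x\le y$ iff $x\to y=1$. It is bounded if there is $0\in X$ with $0\le x$ for all $x\in X$; then $x^*:=x\to 0$ (so $0=1^*$) and the algebra is written $(X,\to,{}^*,1)$. It is involutive if $x^{**}=x$ for all $x$, and implicative if $(x\to y)\to x=x$ for all $x,y$. An implicative-ortholattice is an implicative involutive (bounded) BE algebra. Put $x\wedge_Q y:=((x^*\to y^* )\to y^* )^*$. An implicative-orthomodular lattice is an implicative-ortholattice with $x\wedge_Q(y\to x)=x$ for all $x,y$. In an implicative-ortholattice the relation $x\le_L y$ iff $x=(x\to y^* )^*$ is a bounded lattice order, with meet $(x\to y^* )^*$ and join $x^*\to y$; $X$ is called complete if this lattice is complete. An orthogonality space is a set with a symmetric irreflexive relation $\perp$. The associated orthogonality space of an implicative-ortholattice $X$ is $X'=X\setminus\{0\}$ with $x\perp y$ iff $x^*=x\to y$. For $A\subseteq X'$, $A^\perp=\{x\in X'\mid x\perp a\text{ for all }a\in A\}$; $A$ is orthoclosed if $A=A^{\perp\perp}$; $\complement A^\perp=X'\setminus A^\perp$. For an orthoclosed $A\subseteq X'$, a Sasaki map to $A$ is a map $\varphi:\complement A^\perp\to A$ such that $\varphi x=x$ for all $x\in A$,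 and for all $x,y\in\complement A^\perp$, $\varphi x\perp y$ iff $x\perp\varphi y$. $(X',\perp)$ is a Sasaki space if for every orthoclosed $A\subseteq X'$ there exists a Sasaki map to $A$. *)

theory Defs
  imports "HOL-Algebra.Complete_Lattice"
begin

section \<open>BE algebras and implicative-orthomodular lattices\<close>

locale be_algebra =
  fixes X :: "'a set"
    and imp :: "'a \<Rightarrow> 'a \<Rightarrow> 'a"  (infixr "\<leadsto>" 65)
    and one :: 'a
  assumes imp_closed: "\<lbrakk>x \<in> X; y \<in> X\<rbrakk> \<Longrightarrow> x \<leadsto> y \<in> X"
    and one_closed: "one \<in> X"
    and imp_self: "x \<in> X \<Longrightarrow> x \<leadsto> x = one"
    and imp_one: "x \<in> X \<Longrightarrow> x \<leadsto> one = one"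
    and one_imp: "x \<in> X \<Longrightarrow> one \<leadsto> x = x"
    and imp_exchange: "\<lbrakk>x \<in> X; y \<in> X; z \<in> X\<rbrakk> \<Longrightarrow> x \<leadsto> (y \<leadsto> z) = y \<leadsto> (x \<leadsto> z)"
begin

definition be_le :: "'a \<Rightarrow> 'a \<Rightarrow> bool"
  where "be_le x y \<longleftrightarrow> x \<leadsto> y = one"

end

text \<open>The bound \<open>zero\<close> is a parameter, since \<open>be_le\<close> need not be antisymmetric in a
  general BE algebra; the involution \<open>star\<close> is derived from it.\<close>

locale bounded_be_algebra = be_algebra +
  fixes zero :: 'a
  assumes zero_closed: "zero \<in> X"
    and zero_le: "x \<in> X \<Longrightarrow> be_le zero x"
begin

definition star :: "'a \<Rightarrow> 'a"
  where "star x = x \<leadsto> zero"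

definition meet_Q :: "'a \<Rightarrow> 'a \<Rightarrow> 'a"
  where "meet_Q x y = star ((star x \<leadsto> star y) \<leadsto> star y)"

definition le_L :: "'a \<Rightarrow> 'a \<Rightarrow> bool"
  where "le_L x y \<longleftrightarrow> x = star (x \<leadsto> star y)"

definition order_L :: "'a gorder"
  where "order_L = \<lparr>carrier = X, eq = (=), le = le_L\<rparr>"

definition nonzero :: "'a set"
  where "nonzero = X - {zero}"

definition perp :: "'a \<Rightarrow> 'a \<Rightarrow> bool"
  where "perp x y \<longleftrightarrow> star x = x \<leadsto> y"

end

locale implicative_ortholattice = bounded_be_algebra +
  assumes involutive: "x \<in> X \<Longrightarrow> star (star x) = x"
    and implicative: "\<lbrakk>x \<in> X; y \<in> X\<rbrakk> \<Longrightarrow> (x \<leadsto> y) \<leadsto> x = x"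

locale implicative_orthomodular_lattice = implicative_ortholattice +
  assumes orthomodular: "\<lbrakk>x \<in> X; y \<in> X\<rbrakk> \<Longrightarrow> meet_Q x (y \<leadsto> x) = x"

locale complete_implicative_orthomodular_lattice = implicative_orthomodular_lattice +
  assumes complete: "Complete_Lattice.complete_lattice order_L"


section \<open>Orthogonality spaces and Sasaki spaces\<close>

locale orthogonality_space =
  fixes S :: "'a set"
    and orth :: "'a \<Rightarrow> 'a \<Rightarrow> bool"
  assumes orth_sym: "\<lbrakk>x \<in> S; y \<in> S; orth x y\<rbrakk> \<Longrightarrow> orth y x"
    and orth_irrefl: "x \<in> S \<Longrightarrow> \<not> orth x x"
begin

definition orthocomplement :: "'a set \<Rightarrow> 'a set"
  where "orthocomplement A = {x \<in> S. \<forall>a\<in>A. orth x a}"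

definition orthoclosed :: "'a set \<Rightarrow> bool"
  where "orthoclosed A \<longleftrightarrow> A \<subseteq> S \<and> A = orthocomplement (orthocomplement A)"

text \<open>A Sasaki map has domain \<open>S - orthocomplement A\<close>; the values of the total function
  \<open>\<phi>\<close> outside this set are irrelevant.\<close>

definition sasaki_map :: "'a set \<Rightarrow> ('a \<Rightarrow> 'a) \<Rightarrow> bool"
  where "sasaki_map A \<phi> \<longleftrightarrow>
    \<phi> \<in> (S - orthocomplement A) \<rightarrow> A \<and>
    (\<forall>x\<in>A. \<phi> x = x) \<and>
    (\<forall>x\<in>S - orthocomplement A. \<forall>y\<in>S - orthocomplement A. orth (\<phi> x) y \<longleftrightarrow> orth x (\<phi> y))"

end

locale sasaki_space = orthogonality_space +
  assumes sasaki_map_exists: "orthoclosed A \<Longrightarrow> \<exists>\<phi>. sasaki_map A \<phi>"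

end

theory Submission
  imports Defs
begin

text \<open>
  Under \<open>le_L\<close> the algebra is an ortholattice, and the given axiom \<open>orthomodular\<close> reads
  \<open>a \<and> (a\<^sup>* \<or> x) = x\<close> for \<open>x \<le> a\<close>. So the Sasaki projection \<open>x \<mapsto> a \<and> (a\<^sup>* \<or> x)\<close> fixes every
  \<open>x \<le> a\<close>, and it always lands below \<open>a\<close>.

  Orthogonality of \<open>x\<close> and \<open>y\<close> means \<open>x \<le> y\<^sup>*\<close>. With all suprema at hand, an orthoclosed set
  \<open>A\<close> is the set of nonzero elements below \<open>a = Sup A\<close>, and its orthocomplement is the set of
  nonzero elements below \<open>a\<^sup>*\<close> (\<open>orthocomplement_eq_down_star\<close>, \<open>orthoclosed_eq_down\<close>). The Sasaki
  projection to \<open>a\<close> is then a Sasaki map to \<open>A\<close>. Two points need the orthomodular law in its dual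
  form \<open>a\<^sup>* \<or> (a \<and> (a\<^sup>* \<or> x)) = a\<^sup>* \<or> x\<close>: the projection of \<open>x\<close> vanishes only if \<open>x \<le> a\<^sup>*\<close>
  (\<open>sasaki_projection_eq_zero\<close>), and the projection is self-adjoint with respect to
  orthogonality (\<open>sasaki_projection_adjoint\<close>).
\<close>

section \<open>The ortholattice structure\<close>

context implicative_ortholattice
begin

definition meet :: "'a \<Rightarrow> 'a \<Rightarrow> 'a"
  where "meet x y = star (x \<leadsto> star y)"

definition join :: "'a \<Rightarrow> 'a \<Rightarrow> 'a"
  where "join x y = star x \<leadsto> y"

lemma star_closed [simp]: "x \<in> X \<Longrightarrow> star x \<in> X"
  by (simp add: star_def imp_closed zero_closed)

lemma meet_closed [simp]: "\<lbrakk>x \<in> X; y \<in> X\<rbrakk> \<Longrightarrow> meet x y \<in> X"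
  by (simp add: meet_def imp_closed)

lemma join_closed [simp]: "\<lbrakk>x \<in> X; y \<in> X\<rbrakk> \<Longrightarrow> join x y \<in> X"
  by (simp add: join_def imp_closed)

lemma star_one: "star one = zero"
  by (simp add: star_def one_imp zero_closed)

lemma imp_star_commute: "\<lbrakk>x \<in> X; y \<in> X\<rbrakk> \<Longrightarrow> x \<leadsto> star y = y \<leadsto> star x"
  by (simp add: star_def imp_exchange zero_closed)

lemma star_meet: "\<lbrakk>x \<in> X; y \<in> X\<rbrakk> \<Longrightarrow> star (meet x y) = join (star x) (star y)"
  by (simp add: meet_def join_def involutive imp_closed)

lemma star_join: "\<lbrakk>x \<in> X; y \<in> X\<rbrakk> \<Longrightarrow> star (join x y) = meet (star x) (star y)"
  by (simp add: meet_def join_def involutive)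

lemma meet_commute: "\<lbrakk>x \<in> X; y \<in> X\<rbrakk> \<Longrightarrow> meet x y = meet y x"
  by (simp add: meet_def imp_star_commute)

lemma join_commute: "\<lbrakk>x \<in> X; y \<in> X\<rbrakk> \<Longrightarrow> join x y = join y x"
  using imp_star_commute[of "star x" "star y"] by (simp add: join_def involutive)

lemma meet_idem: "x \<in> X \<Longrightarrow> meet x x = x"
  using implicative[of "star x" zero]
  by (simp add: meet_def zero_closed involutive flip: star_def)

text \<open>After contraposing, both sides are nested implications whose premises are exchanged.\<close>

lemma meet_assoc:
  assumes "x \<in> X" "y \<in> X" "z \<in> X"
  shows "meet (meet x y) z = meet x (meet y z)"
proof -
  have "meet x y \<leadsto> star z = z \<leadsto> (x \<leadsto> star y)"
    using assms imp_star_commute[of "meet x y" z]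
    by (simp add: meet_def imp_closed involutive)
  also have "\<dots> = x \<leadsto> (z \<leadsto> star y)"
    using assms by (simp add: imp_exchange)
  also have "\<dots> = x \<leadsto> star (meet y z)"
    using assms by (simp add: meet_def imp_closed involutive imp_star_commute[of z y])
  finally show ?thesis
    by (simp add: meet_def)
qed

text \<open>Absorption is the implicative law, read through the contrapositive.\<close>

lemma meet_join_absorb:
  assumes "x \<in> X" "y \<in> X"
  shows "meet x (join x y) = x"
proof -
  have "x \<leadsto> star (join x y) = join x y \<leadsto> star x"
    using assms by (simp add: imp_star_commute)
  also have "\<dots> = star x"
    using assms implicative[of "star x" y] by (simp add: join_def)
  finally show ?thesis
    using assms by (simp add: meet_def involutive)
qed

lemma le_L_iff_meet: "le_L x y \<longleftrightarrow> x = meet x y"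
  by (simp add: le_L_def meet_def)

lemma le_L_refl: "x \<in> X \<Longrightarrow> le_L x x"
  by (simp add: le_L_iff_meet meet_idem)

lemma le_L_antisym: "\<lbrakk>x \<in> X; y \<in> X; le_L x y; le_L y x\<rbrakk> \<Longrightarrow> x = y"
  by (metis le_L_iff_meet meet_commute)

lemma le_L_trans: "\<lbrakk>x \<in> X; y \<in> X; z \<in> X; le_L x y; le_L y z\<rbrakk> \<Longrightarrow> le_L x z"
  by (metis le_L_iff_meet meet_assoc)

lemma le_L_join1: "\<lbrakk>x \<in> X; y \<in> X\<rbrakk> \<Longrightarrow> le_L x (join x y)"
  by (simp add: le_L_iff_meet meet_join_absorb)

lemma le_L_join2: "\<lbrakk>x \<in> X; y \<in> X\<rbrakk> \<Longrightarrow> le_L y (join x y)"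
  by (metis le_L_join1 join_commute)

lemma meet_le1: "\<lbrakk>x \<in> X; y \<in> X\<rbrakk> \<Longrightarrow> le_L (meet x y) x"
  by (metis le_L_iff_meet meet_assoc meet_closed meet_commute meet_idem)

lemma meet_le2: "\<lbrakk>x \<in> X; y \<in> X\<rbrakk> \<Longrightarrow> le_L (meet x y) y"
  by (metis meet_le1 meet_commute)

lemma le_meetI: "\<lbrakk>x \<in> X; y \<in> X; z \<in> X; le_L z x; le_L z y\<rbrakk> \<Longrightarrow> le_L z (meet x y)"
  by (metis le_L_iff_meet meet_assoc)

text \<open>By De Morgan, \<open>x = x \<and> y\<close> gives \<open>x\<^sup>* = x\<^sup>* \<or> y\<^sup>*\<close>, and absorption puts \<open>y\<^sup>*\<close> below this join.\<close>

lemma star_antimono: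
  assumes "x \<in> X" "y \<in> X" "le_L x y"
  shows "le_L (star y) (star x)"
proof -
  have "star x = join (star x) (star y)"
    using assms by (metis le_L_iff_meet star_meet)
  then show ?thesis
    using le_L_join2[of "star x" "star y"] assms by simp
qed

lemma le_star_commute: "\<lbrakk>x \<in> X; y \<in> X\<rbrakk> \<Longrightarrow> le_L x (star y) \<longleftrightarrow> le_L y (star x)"
  by (metis star_antimono involutive star_closed)

lemma join_leI:
  assumes "x \<in> X" "y \<in> X" "z \<in> X" "le_L x z" "le_L y z"
  shows "le_L (join x y) z"
proof -
  have "le_L (star z) (star (join x y))"
    using assms by (simp add: star_join le_meetI star_antimono)
  then show ?thesis
    using assms by (metis star_antimono involutive star_closed join_closed)
qed

lemma le_one: "x \<in> X \<Longrightarrow> le_L x one"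
  by (simp add: le_L_def star_one involutive flip: star_def)

lemma zero_le_L: "x \<in> X \<Longrightarrow> le_L zero x"
  using le_one[of "star x"] le_star_commute[of x one]
  by (metis involutive one_closed star_antimono star_closed star_one)

lemma le_zero_iff: "x \<in> X \<Longrightarrow> le_L x zero \<longleftrightarrow> x = zero"
  using le_L_antisym le_L_refl zero_closed zero_le_L by blast

lemma meet_star_self: "x \<in> X \<Longrightarrow> meet x (star x) = zero"
  by (simp add: meet_def involutive imp_self star_one)

lemma perp_iff_le_star: "\<lbrakk>x \<in> X; y \<in> X\<rbrakk> \<Longrightarrow> perp x y \<longleftrightarrow> le_L x (star y)"
  by (metis perp_def le_L_def involutive imp_closed)

lemma perp_commute: "\<lbrakk>x \<in> X; y \<in> X\<rbrakk> \<Longrightarrow> perp x y \<longleftrightarrow> perp y x"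
  by (simp add: perp_iff_le_star le_star_commute)

lemma nonzero_iff: "x \<in> nonzero \<longleftrightarrow> x \<in> X \<and> x \<noteq> zero"
  by (simp add: nonzero_def)

lemma not_perp_self: "x \<in> nonzero \<Longrightarrow> \<not> perp x x"
  using perp_iff_le_star[of x x] meet_star_self[of x] by (auto simp: nonzero_iff le_L_iff_meet)

lemma orthogonality_space_nonzero: "orthogonality_space nonzero perp"
  by unfold_locales (auto simp: nonzero_iff perp_commute not_perp_self)

end


section \<open>Sasaki projections\<close>

context implicative_orthomodular_lattice
begin

definition sasaki_projection :: "'a \<Rightarrow> 'a \<Rightarrow> 'a"
  where "sasaki_projection a x = meet a (join (star a) x)"

lemma sasaki_projection_closed [simp]:
  "\<lbrakk>a \<in> X; x \<in> X\<rbrakk> \<Longrightarrow> sasaki_projection a x \<in> X"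
  by (simp add: sasaki_projection_def)

lemma sasaki_projection_le: "\<lbrakk>a \<in> X; x \<in> X\<rbrakk> \<Longrightarrow> le_L (sasaki_projection a x) a"
  by (simp add: sasaki_projection_def meet_le1)

text \<open>
  The element \<open>a\<close> above \<open>x\<close> has the form \<open>y \<leadsto> x\<close> with \<open>y = a\<^sup>*\<close>. For this \<open>y\<close> the quantum meet
  of \<open>x\<close> and \<open>y \<leadsto> x\<close> unfolds to the Sasaki projection of \<open>x\<close> to \<open>a\<close>.
\<close>

lemma sasaki_projection_fixes:
  assumes "a \<in> X" "x \<in> X" "le_L x a"
  shows "sasaki_projection a x = x"
proof -
  have a: "star a \<leadsto> x = a"
  proof -
    have "join a x = a"
      using assms by (meson join_closed join_leI le_L_antisym le_L_join1 le_L_refl)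
    then show ?thesis by (simp add: join_def)
  qed
  have "star x \<leadsto> star a = join (star a) x"
    using assms imp_star_commute[of "star x" a] by (simp add: join_def involutive)
  then have "meet_Q x a = meet (join (star a) x) a"
    by (simp add: meet_Q_def meet_def)
  also have "\<dots> = sasaki_projection a x"
    using assms by (simp add: sasaki_projection_def meet_commute)
  finally show ?thesis
    using orthomodular[of x "star a"] assms a by simp
qed

text \<open>
  The dual orthomodular law: apply \<open>sasaki_projection_fixes\<close> to \<open>(a\<^sup>* \<or> x)\<^sup>* \<le> a\<close> and take
  complements.
\<close>

lemma join_star_sasaki_projection:
  assumes "a \<in> X" "x \<in> X"
  shows "join (star a) (sasaki_projection a x) = join (star a) x"
proof -
  let ?u = "star (join (star a) x)"
  have "le_L ?u a"
    using assms by (simp add: star_join involutive meet_le1)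
  then have "sasaki_projection a ?u = ?u"
    using assms by (simp add: sasaki_projection_fixes)
  then have "star (sasaki_projection a ?u) = join (star a) x"
    using assms by (simp add: involutive)
  moreover have "star (sasaki_projection a ?u) = join (star a) (sasaki_projection a x)"
    using assms by (simp add: sasaki_projection_def star_meet star_join[of "star a" "?u"] involutive)
  ultimately show ?thesis by simp
qed

lemma star_sasaki_projection:
  "\<lbrakk>a \<in> X; y \<in> X\<rbrakk> \<Longrightarrow> star (sasaki_projection a y) = join (star a) (meet a (star y))"
  by (simp add: sasaki_projection_def star_meet star_join involutive)

lemma sasaki_projection_eq_zero:
  assumes "a \<in> X" "x \<in> X" "sasaki_projection a x = zero"
  shows "le_L x (star a)"
proof -
  have "join (star a) x = join (star a) zero"
    using assms join_star_sasaki_projection[of a x] by simp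
  also have "\<dots> = star a"
    using assms by (simp add: join_def involutive flip: star_def)
  finally show ?thesis
    using le_L_join2[of "star a" x] assms by simp
qed

text \<open>
  A projection \<open>p\<close> of \<open>x\<close> below \<open>y\<^sup>*\<close> is below \<open>a \<and> y\<^sup>*\<close>, so
  \<open>x \<le> a\<^sup>* \<or> x = a\<^sup>* \<or> p \<le> a\<^sup>* \<or> (a \<and> y\<^sup>*)\<close>, which is the complement of the projection of \<open>y\<close>.
\<close>

lemma perp_sasaki_projectionD:
  assumes "a \<in> X" "x \<in> X" "y \<in> X" "perp (sasaki_projection a x) y"
  shows "perp x (sasaki_projection a y)"
proof -
  let ?p = "sasaki_projection a x" and ?m = "meet a (star y)"
  have "le_L ?p ?m"
    using assms by (simp add: perp_iff_le_star le_meetI sasaki_projection_le)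
  then have "le_L ?p (join (star a) ?m)"
    using assms le_L_trans[of ?p ?m "join (star a) ?m"] by (simp add: le_L_join2)
  then have "le_L (join (star a) ?p) (join (star a) ?m)"
    using assms by (simp add: join_leI le_L_join1)
  then have "le_L (join (star a) x) (join (star a) ?m)"
    using assms by (simp add: join_star_sasaki_projection)
  then have "le_L x (join (star a) ?m)"
    using assms le_L_trans[of x "join (star a) x" "join (star a) ?m"] by (simp add: le_L_join2)
  then show ?thesis
    using assms by (simp add: perp_iff_le_star star_sasaki_projection)
qed

lemma sasaki_projection_adjoint:
  assumes "a \<in> X" "x \<in> X" "y \<in> X"
  shows "perp (sasaki_projection a x) y \<longleftrightarrow> perp x (sasaki_projection a y)"
  using perp_sasaki_projectionD[of a x y] perp_sasaki_projectionD[of a y x] assms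
  by (auto simp: perp_commute)

end


section \<open>Orthoclosed sets and suprema\<close>

context complete_implicative_orthomodular_lattice
begin

lemma sup_exists:
  assumes "A \<subseteq> X"
  obtains a where "a \<in> X" "\<And>x. x \<in> X \<Longrightarrow> le_L a x \<longleftrightarrow> (\<forall>c\<in>A. le_L c x)"
proof -
  obtain a where "least order_L a (Upper order_L A)"
    using complete_lattice.sup_exists[OF complete, of A] assms by (auto simp: order_L_def)
  then have a: "a \<in> X" "\<And>c. c \<in> A \<Longrightarrow> le_L c a"
    "\<And>x. \<lbrakk>x \<in> X; \<And>c. c \<in> A \<Longrightarrow> le_L c x\<rbrakk> \<Longrightarrow> le_L a x"
    using assms unfolding least_def Upper_def order_L_def by auto
  have "le_L a x \<longleftrightarrow> (\<forall>c\<in>A. le_L c x)" if "x \<in> X" for x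
    using a that assms le_L_trans[of _ a x] by blast
  then show thesis
    using a(1) that by blast
qed

interpretation orthogonality_space nonzero perp
  by (fact orthogonality_space_nonzero)

text \<open>
  Since \<open>x \<le> c\<^sup>*\<close> iff \<open>c \<le> x\<^sup>*\<close>, an element \<open>x\<close> is orthogonal to all of \<open>A\<close> iff \<open>x\<^sup>*\<close> is an upper
  bound of \<open>A\<close>, which is a condition on the supremum alone.
\<close>

lemma orthocomplement_eq_down_star:
  assumes "A \<subseteq> X" "a \<in> X"
    and sup: "\<And>x. x \<in> X \<Longrightarrow> le_L a x \<longleftrightarrow> (\<forall>c\<in>A. le_L c x)"
  shows "orthocomplement A = {x \<in> nonzero. le_L x (star a)}"
proof -
  have "(\<forall>c\<in>A. perp x c) \<longleftrightarrow> le_L x (star a)" if "x \<in> X" for x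
  proof -
    have "(\<forall>c\<in>A. perp x c) \<longleftrightarrow> (\<forall>c\<in>A. le_L c (star x))"
      using that assms(1) by (meson le_star_commute perp_iff_le_star subsetD)
    also have "\<dots> \<longleftrightarrow> le_L a (star x)"
      using sup[of "star x"] that by simp
    finally show ?thesis
      using le_star_commute[of a x] that assms(2) by simp
  qed
  then show ?thesis
    by (auto simp: orthocomplement_def nonzero_iff)
qed

text \<open>
  The elements below \<open>a\<^sup>*\<close> have supremum \<open>a\<^sup>*\<close>, also when \<open>0\<close> is left out and when \<open>a\<^sup>* = 0\<close>
  leaves no elements at all. Thus the previous lemma applies a second time.
\<close>

lemma orthoclosed_eq_down:
  assumes "orthoclosed A" "a \<in> X"
    and sup: "\<And>x. x \<in> X \<Longrightarrow> le_L a x \<longleftrightarrow> (\<forall>c\<in>A. le_L c x)"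
  shows "A = {x \<in> nonzero. le_L x a}"
proof -
  let ?B = "{x \<in> nonzero. le_L x (star a)}"
  have "A \<subseteq> X" and closed: "A = orthocomplement (orthocomplement A)"
    using assms(1) by (auto simp: orthoclosed_def nonzero_iff)
  have "le_L (star a) x \<longleftrightarrow> (\<forall>c\<in>?B. le_L c x)" if "x \<in> X" for x
  proof
    show "\<forall>c\<in>?B. le_L c x" if "le_L (star a) x"
      using that \<open>x \<in> X\<close> \<open>a \<in> X\<close> le_L_trans[of _ "star a" x] by (auto simp: nonzero_iff)
    show "le_L (star a) x" if "\<forall>c\<in>?B. le_L c x"
      using that \<open>x \<in> X\<close> \<open>a \<in> X\<close> zero_le_L[of x] le_L_refl[of "star a"]
      by (cases "star a = zero") (auto simp: nonzero_iff)
  qed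
  then have "orthocomplement ?B = {x \<in> nonzero. le_L x (star (star a))}"
    using \<open>a \<in> X\<close> by (intro orthocomplement_eq_down_star) (auto simp: nonzero_iff)
  then show ?thesis
    using closed orthocomplement_eq_down_star[OF \<open>A \<subseteq> X\<close> \<open>a \<in> X\<close> sup] \<open>a \<in> X\<close>
    by (simp add: involutive)
qed

lemma sasaki_map_sasaki_projection:
  assumes "orthoclosed A" "a \<in> X"
    and sup: "\<And>x. x \<in> X \<Longrightarrow> le_L a x \<longleftrightarrow> (\<forall>c\<in>A. le_L c x)"
  shows "sasaki_map A (sasaki_projection a)"
proof -
  have "A \<subseteq> X"
    using assms(1) by (auto simp: orthoclosed_def nonzero_iff)
  have perp_A: "orthocomplement A = {x \<in> nonzero. le_L x (star a)}"
    using \<open>A \<subseteq> X\<close> \<open>a \<in> X\<close> sup by (rule orthocomplement_eq_down_star)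
  have A: "A = {x \<in> nonzero. le_L x a}"
    using assms by (rule orthoclosed_eq_down)
  have "sasaki_projection a x \<in> A" if "x \<in> nonzero - orthocomplement A" for x
  proof -
    have "x \<in> X" "\<not> le_L x (star a)"
      using that perp_A by (auto simp: nonzero_iff)
    then have "sasaki_projection a x \<in> nonzero"
      using \<open>a \<in> X\<close> sasaki_projection_eq_zero[of a x] by (auto simp: nonzero_iff)
    then show ?thesis
      using A \<open>a \<in> X\<close> \<open>x \<in> X\<close> sasaki_projection_le[of a x] by blast
  qed
  moreover have "sasaki_projection a x = x" if "x \<in> A" for x
    using that A \<open>a \<in> X\<close> sasaki_projection_fixes[of a x] by (auto simp: nonzero_iff)
  moreover have "perp (sasaki_projection a x) y \<longleftrightarrow> perp x (sasaki_projection a y)"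
    if "x \<in> nonzero" "y \<in> nonzero" for x y
    using that \<open>a \<in> X\<close> by (simp add: nonzero_iff sasaki_projection_adjoint)
  ultimately show ?thesis
    unfolding sasaki_map_def by blast
qed

lemma sasaki_space_nonzero: "sasaki_space nonzero perp"
proof
  fix A
  assume A: "orthoclosed A"
  then have "A \<subseteq> X"
    by (auto simp: orthoclosed_def nonzero_iff)
  then obtain a where "a \<in> X" "\<And>x. x \<in> X \<Longrightarrow> le_L a x \<longleftrightarrow> (\<forall>c\<in>A. le_L c x)"
    using sup_exists by blast
  then show "\<exists>\<phi>. sasaki_map A \<phi>"
    using sasaki_map_sasaki_projection[OF A] by blast
qed

end

theorem theorem7p6:
  fixes X :: "'a set" and imp :: "'a \<Rightarrow> 'a \<Rightarrow> 'a" and one zero :: 'a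
  assumes "complete_implicative_orthomodular_lattice X imp one zero"
  shows "sasaki_space (bounded_be_algebra.nonzero X zero) (bounded_be_algebra.perp imp zero)"
  using assms by (rule complete_implicative_orthomodular_lattice.sasaki_space_nonzero)

end
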